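(* Let $\mu\geq\nu>-1$. Then the functions $f_{\mu,\nu},g_{\mu,\nu},q_\nu$ defined on $[0,\alpha_{\nu,1}^2)$ by $$g_{\mu,\nu}(x)=x^{\frac{\nu-\mu}{2}}e^{\frac{3x}{4}\left(\frac{1}{\mu+1}-\frac{1}{\nu+1}\right)}\frac{d_\mu(\sqrt{x})}{d_\nu(\sqrt{x})},\qquad f_{\mu,\nu}(x)=\big(\log g_{\mu,\nu}(x)\big)',\qquad q_\nu(x)=\frac{x^{\nu/2}e^{-\frac{3x}{4(\nu+1)}}}{d_\nu(\sqrt{x})},$$ (with values at $x=0$ understood by continuity) are absolutely monotonic on $[0,\alpha_{\nu,1}^2)$.
   Context: $J_\nu$ denotes the Bessel function of the first kind of order $\nu$. The Dini function is $d_\nu(x)=(1-\nu)J_\nu(x)+xJ_\nu'(x)$, and $0<\alpha_{\nu,1}<\alpha_{\nu,2}<\cdots$ denote its positive zeros. For $x>0$, $x^{s}$ denotes the positive real power. Note $x^{-\nu/2}d_\nu(\sqrt x)$ extends to an entire function of $x$ with value $1/(2^\nu\Gamma(\nu+1))$ at $0$. A function $f:I\to\mathbb{R}$ is absolutely monotonic on an interval $I$ if $f^{(n)}(x)\ge0$ for all $x\in I$ and all $n\in\{0,1,2,\dots\}$. *)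

theory Defs
  imports "HOL-Analysis.Analysis"
begin

definition besselJ :: "real \<Rightarrow> real \<Rightarrow> real" where
  "besselJ \<nu> x = (\<Sum>k. (-1) ^ k / (fact k * Gamma (real k + \<nu> + 1)) * (x / 2) powr (2 * real k + \<nu>))"

definition dini :: "real \<Rightarrow> real \<Rightarrow> real" where
  "dini \<nu> x = (1 - \<nu>) * besselJ \<nu> x + x * deriv (besselJ \<nu>) x"

definition dini_zero1 :: "real \<Rightarrow> real" where
  "dini_zero1 \<nu> = Inf {x. 0 < x \<and> dini \<nu> x = 0}"

definition ext0 :: "(real \<Rightarrow> real) \<Rightarrow> real \<Rightarrow> real" where
  "ext0 h x = (if x = 0 then Lim (at_right 0) h else h x)"

definition g_raw :: "real \<Rightarrow> real \<Rightarrow> real \<Rightarrow> real" where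
  "g_raw \<mu> \<nu> x = x powr ((\<nu> - \<mu>) / 2) * exp (3 * x / 4 * (1 / (\<mu> + 1) - 1 / (\<nu> + 1)))
      * dini \<mu> (sqrt x) / dini \<nu> (sqrt x)"

definition f_raw :: "real \<Rightarrow> real \<Rightarrow> real \<Rightarrow> real" where
  "f_raw \<mu> \<nu> x = deriv (\<lambda>t. ln (g_raw \<mu> \<nu> t)) x"

definition q_raw :: "real \<Rightarrow> real \<Rightarrow> real" where
  "q_raw \<nu> x = x powr (\<nu> / 2) * exp (- (3 * x) / (4 * (\<nu> + 1))) / dini \<nu> (sqrt x)"

definition g_fun :: "real \<Rightarrow> real \<Rightarrow> real \<Rightarrow> real" where
  "g_fun \<mu> \<nu> = ext0 (g_raw \<mu> \<nu>)"

definition f_fun :: "real \<Rightarrow> real \<Rightarrow> real \<Rightarrow> real" where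
  "f_fun \<mu> \<nu> = ext0 (f_raw \<mu> \<nu>)"

definition q_fun :: "real \<Rightarrow> real \<Rightarrow> real" where
  "q_fun \<nu> = ext0 (q_raw \<nu>)"

definition absolutely_monotonic_on :: "real set \<Rightarrow> (real \<Rightarrow> real) \<Rightarrow> bool" where
  "absolutely_monotonic_on I f \<longleftrightarrow>
     (\<exists>F :: nat \<Rightarrow> real \<Rightarrow> real.
        (\<forall>x\<in>I. F 0 x = f x) \<and>
        (\<forall>n. \<forall>x\<in>I. (F n has_real_derivative F (Suc n) x) (at x within I)) \<and>
        (\<forall>n. \<forall>x\<in>I. 0 \<le> F n x))"

end

theory Submission
  imports Defs "HOL-Complex_Analysis.Laurent_Convergence" "HOL-Real_Asymp.Real_Asymp"
begin

text \<open>
  Let \<open>u\<close> be the normalised Bessel series, so that \<open>D = u + 2xu'\<close> is the normalised Dini series.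
  The logarithmic derivative \<open>h = -u'/u\<close> of \<open>1/u\<close> satisfies the Riccati equation
  \<open>xh' + (\<nu> + 1)h = xh\<^sup>2 + 1/4\<close>, a recursion which shows that its coefficients are nonnegative
  and decreasing in \<open>\<nu>\<close>. Since \<open>D = u(1 - 2xh)\<close>, the same holds for
  \<open>-D'/D = h + (2xh)'/(1 - 2xh)\<close>. Let \<open>P\<close> be \<open>D\<close> times the exponential that cancels the constant
  term of this series. Up to constants, \<open>q\<^sub>\<nu>\<close> is \<open>1/P\<^sub>\<nu>\<close> and \<open>g = q\<^sub>\<nu>/q\<^sub>\<mu>\<close> is \<open>P\<^sub>\<mu>/P\<^sub>\<nu>\<close>, while \<open>f\<close> is the
  difference of the logarithmic derivatives of \<open>1/P\<^sub>\<nu>\<close> and \<open>1/P\<^sub>\<mu>\<close>; and a series with positive constant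
  term inherits nonnegative coefficients from its logarithmic derivative. A Pringsheim-type argument
  shows that these series converge up to the first positive zero of \<open>D\<^sub>\<nu>\<close>; the product expansion of
  \<open>D\<close> is never used.
\<close>

unbundle no vec_syntax
unbundle fps_syntax

section \<open>Coefficientwise domination of power series\<close>

definition fps_nonneg_le_upto ::
    "nat \<Rightarrow> 'a::linordered_semidom fps \<Rightarrow> 'a fps \<Rightarrow> bool" where
  "fps_nonneg_le_upto n F G \<longleftrightarrow> (\<forall>i\<le>n. 0 \<le> F $ i \<and> F $ i \<le> G $ i)"

definition fps_nonneg_le :: "'a::linordered_semidom fps \<Rightarrow> 'a fps \<Rightarrow> bool" where
  "fps_nonneg_le F G \<longleftrightarrow> (\<forall>n. 0 \<le> F $ n \<and> F $ n \<le> G $ n)"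

abbreviation fps_nonneg :: "'a::linordered_semidom fps \<Rightarrow> bool" where
  "fps_nonneg F \<equiv> fps_nonneg_le F F"

lemma fps_nonneg_le_nth:
  assumes "fps_nonneg_le F G"
  shows "0 \<le> F $ n" and "F $ n \<le> G $ n"
  using assms by (simp_all add: fps_nonneg_le_def)

lemma fps_nonneg_le_imp_upto: "fps_nonneg_le F G \<Longrightarrow> fps_nonneg_le_upto n F G"
  by (simp add: fps_nonneg_le_def fps_nonneg_le_upto_def)

lemma fps_nonneg_le_induct [case_names 0 Suc]:
  assumes "0 \<le> F $ 0 \<and> F $ 0 \<le> G $ 0"
    and "\<And>n. fps_nonneg_le_upto n F G \<Longrightarrow> 0 \<le> F $ Suc n \<and> F $ Suc n \<le> G $ Suc n"
  shows "fps_nonneg_le F G"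
proof -
  have "fps_nonneg_le_upto n F G" for n
    by (induction n) (use assms in \<open>auto simp: fps_nonneg_le_upto_def le_Suc_eq\<close>)
  then show ?thesis
    by (auto simp: fps_nonneg_le_def fps_nonneg_le_upto_def)
qed

lemma fps_nonneg_le_upto_mult:
  assumes F: "fps_nonneg_le_upto n F F'" and G: "fps_nonneg_le_upto n G G'"
  shows "fps_nonneg_le_upto n (F * G) (F' * G')"
proof -
  have term_le: "0 \<le> F $ i * G $ (m - i) \<and> F $ i * G $ (m - i) \<le> F' $ i * G' $ (m - i)"
    if "m \<le> n" "i \<le> m" for m i
  proof -
    have "0 \<le> F $ i \<and> F $ i \<le> F' $ i" "0 \<le> G $ (m - i) \<and> G $ (m - i) \<le> G' $ (m - i)"
      using F G that by (simp_all add: fps_nonneg_le_upto_def)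
    then show ?thesis
      by (meson mult_mono mult_nonneg_nonneg order_trans)
  qed
  then show ?thesis
    by (auto simp: fps_nonneg_le_upto_def fps_mult_nth intro!: sum_nonneg sum_mono)
qed

lemma fps_nonneg_le_mult:
  assumes "fps_nonneg_le F F'" "fps_nonneg_le G G'"
  shows "fps_nonneg_le (F * G) (F' * G')"
proof -
  have "fps_nonneg_le_upto n (F * G) (F' * G')" for n
    using assms by (intro fps_nonneg_le_upto_mult fps_nonneg_le_imp_upto)
  then show ?thesis
    by (auto simp: fps_nonneg_le_def fps_nonneg_le_upto_def)
qed

lemma fps_nonneg_le_add:
  "fps_nonneg_le F F' \<Longrightarrow> fps_nonneg_le G G' \<Longrightarrow> fps_nonneg_le (F + G) (F' + G')"
  by (simp add: fps_nonneg_le_def add_mono)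

lemma fps_nonneg_le_deriv: "fps_nonneg_le F G \<Longrightarrow> fps_nonneg_le (fps_deriv F) (fps_deriv G)"
  by (auto simp: fps_nonneg_le_def intro!: mult_left_mono mult_nonneg_nonneg)

lemma fps_inverse_one_minus_nth_Suc:
  fixes F :: "'a::field fps"
  assumes "F $ 0 = 0"
  shows "inverse (1 - F) $ Suc n = (fps_shift 1 F * inverse (1 - F)) $ n"
proof -
  have "(1 - F) * inverse (1 - F) = 1"
    using assms by (intro inverse_mult_eq_1') simp
  then have "inverse (1 - F) = 1 + F * inverse (1 - F)"
    by (simp add: algebra_simps)
  also have "F * inverse (1 - F) = fps_X * (fps_shift 1 F * inverse (1 - F))"
  proof -
    have "F = fps_X * fps_shift 1 F"
      using assms by (intro fps_ext) simp
    then show ?thesis by (metis mult.assoc)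
  qed
  finally have "inverse (1 - F) $ Suc n
      = (1 + fps_X * (fps_shift 1 F * inverse (1 - F))) $ Suc n"
    by (rule arg_cong)
  then show ?thesis by simp
qed

lemma fps_nonneg_le_inverse_one_minus:
  fixes F G :: "'a::linordered_field fps"
  assumes FG: "fps_nonneg_le F G" and "F $ 0 = 0" "G $ 0 = 0"
  shows "fps_nonneg_le (inverse (1 - F)) (inverse (1 - G))"
proof -
  have shift: "fps_nonneg_le (fps_shift 1 F) (fps_shift 1 G)"
    using FG by (simp add: fps_nonneg_le_def)
  show ?thesis
  proof (induction rule: fps_nonneg_le_induct)
    case 0
    show ?case using assms by simp
  next
    case (Suc n)
    have "fps_nonneg_le_upto n
        (fps_shift 1 F * inverse (1 - F)) (fps_shift 1 G * inverse (1 - G))"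
      by (intro fps_nonneg_le_upto_mult fps_nonneg_le_imp_upto shift Suc)
    then show ?case
      using assms by (simp add: fps_inverse_one_minus_nth_Suc fps_nonneg_le_upto_def)
  qed
qed

section \<open>Logarithmic derivatives of power series\<close>

definition fps_log_deriv :: "'a::field fps \<Rightarrow> 'a fps" where
  "fps_log_deriv F = fps_deriv F * inverse F"

lemma fps_log_deriv_times_self: "F $ 0 \<noteq> 0 \<Longrightarrow> fps_log_deriv F * F = fps_deriv F"
  by (simp add: fps_log_deriv_def mult.assoc inverse_mult_eq_1)

lemma fps_log_deriv_mult:
  assumes "F $ 0 \<noteq> 0" "G $ 0 \<noteq> 0"
  shows "fps_log_deriv (F * G) = fps_log_deriv F + fps_log_deriv G"
proof -
  have "fps_log_deriv (F * G)
      = fps_deriv F * inverse F * (G * inverse G) + fps_deriv G * inverse G * (F * inverse F)"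
    by (simp add: fps_log_deriv_def fps_inverse_mult algebra_simps)
  then show ?thesis
    using assms by (simp add: fps_log_deriv_def inverse_mult_eq_1')
qed

lemma fps_log_deriv_inverse:
  assumes "F $ 0 \<noteq> 0"
  shows "fps_log_deriv (inverse F) = - fps_log_deriv F"
proof -
  have "fps_log_deriv (inverse F) = - fps_deriv F * inverse F * (inverse F * F)"
    using assms by (simp add: fps_log_deriv_def fps_inverse_deriv power2_eq_square mult.assoc)
  then show ?thesis
    using assms by (simp add: fps_log_deriv_def inverse_mult_eq_1)
qed

lemma fps_log_deriv_exp: "fps_log_deriv (fps_exp c) = fps_const (c :: 'a::field_char_0)"
  by (simp add: fps_log_deriv_def mult.assoc inverse_mult_eq_1')

lemma fps_deriv_log_deriv:
  assumes "F $ 0 \<noteq> 0"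
  shows "fps_deriv (fps_log_deriv F) = fps_deriv (fps_deriv F) * inverse F - (fps_log_deriv F)\<^sup>2"
  using assms by (simp add: fps_log_deriv_def fps_inverse_deriv power2_eq_square algebra_simps)

lemma fps_nonneg_le_if_log_deriv:
  fixes F G :: "'a::linordered_field fps"
  assumes log_deriv: "fps_nonneg_le (fps_log_deriv F) (fps_log_deriv G)"
    and pos: "0 < F $ 0" and init: "F $ 0 \<le> G $ 0"
  shows "fps_nonneg_le F G"
proof (rule fps_nonneg_le_induct)
  fix n
  assume "fps_nonneg_le_upto n F G"
  then have "fps_nonneg_le_upto n (fps_log_deriv F * F) (fps_log_deriv G * G)"
    by (rule fps_nonneg_le_upto_mult[OF fps_nonneg_le_imp_upto[OF log_deriv]])
  then have "fps_nonneg_le_upto n (fps_deriv F) (fps_deriv G)"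
    using pos init by (simp add: fps_log_deriv_times_self)
  then have "0 \<le> of_nat (Suc n) * F $ Suc n
      \<and> of_nat (Suc n) * F $ Suc n \<le> of_nat (Suc n) * G $ Suc n"
    by (simp add: fps_nonneg_le_upto_def)
  then show "0 \<le> F $ Suc n \<and> F $ Suc n \<le> G $ Suc n"
    by (simp only: mult_le_cancel_left_pos zero_le_mult_iff of_nat_0_less_iff zero_less_Suc)
       (auto simp del: of_nat_Suc)
qed (use pos init in simp)

section \<open>Convergence and evaluation\<close>

lemma norm_less_fps_conv_radius:
  "x \<in> {0..<a} \<Longrightarrow> ereal a \<le> fps_conv_radius F \<Longrightarrow> ereal (norm x) < fps_conv_radius F"
  by (rule less_le_trans[of _ "ereal a"]) simp_all

lemma fps_conv_radius_antimono:
  fixes F :: "'a::{banach, real_normed_div_algebra} fps"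
    and G :: "'b::{banach, real_normed_div_algebra} fps"
  assumes "\<And>n. norm (F $ n) \<le> norm (G $ n)"
  shows "fps_conv_radius G \<le> fps_conv_radius F"
  unfolding fps_conv_radius_def[of F]
proof (rule conv_radius_geI_ex')
  fix r :: real assume r: "0 < r" "ereal r < fps_conv_radius G"
  then have "summable (\<lambda>n. norm (G $ n * of_real r ^ n))"
    by (intro norm_summable_fps) simp
  then show "summable (\<lambda>n. F $ n * of_real r ^ n)"
    by (rule summable_comparison_test'[of _ 0])
       (use assms r in \<open>simp add: norm_mult norm_power mult_right_mono\<close>)
qed

lemma fps_conv_radius_log_deriv_ge:
  fixes F :: "'a::{banach, real_normed_field} fps"
  assumes "r \<le> fps_conv_radius F" "r \<le> fps_conv_radius (inverse F)"
  shows "r \<le> fps_conv_radius (fps_log_deriv F)"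
  unfolding fps_log_deriv_def
  using assms fps_conv_radius_deriv[of F] by (intro fps_conv_radius_mult_ge) auto

lemma eval_fps_mult_inverse:
  fixes F :: "'a::{banach, real_normed_field} fps"
  assumes "F $ 0 \<noteq> 0"
    and "ereal (norm z) < fps_conv_radius F" "ereal (norm z) < fps_conv_radius (inverse F)"
  shows "eval_fps F z * eval_fps (inverse F) z = 1"
  using assms by (simp add: inverse_mult_eq_1' flip: eval_fps_mult)

lemma eval_fps_ge_nth_0:
  assumes "fps_nonneg F" "0 \<le> x" "ereal x < fps_conv_radius F"
  shows "F $ 0 \<le> eval_fps F x"
proof -
  have "(\<Sum>n\<in>{0}. F $ n * x ^ n) \<le> eval_fps F x"
    unfolding eval_fps_def
    using assms by (intro sum_le_suminf summable_fps) (auto simp: fps_nonneg_le_nth)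
  then show ?thesis by simp
qed

lemma has_real_derivative_ln_eval_fps:
  assumes "F $ 0 \<noteq> 0" "0 < eval_fps F x"
    and x: "ereal (norm x) < fps_conv_radius F" "ereal (norm x) < fps_conv_radius (inverse F)"
  shows "((\<lambda>t. ln (eval_fps F t)) has_real_derivative eval_fps (fps_log_deriv F) x) (at x)"
proof -
  have "inverse (eval_fps F x) = eval_fps (inverse F) x"
    using eval_fps_mult_inverse[OF assms(1) x] by (simp add: inverse_unique)
  moreover have "ereal (norm x) < fps_conv_radius (fps_deriv F)"
    using x(1) fps_conv_radius_deriv by (rule less_le_trans)
  ultimately have "eval_fps (fps_log_deriv F) x
      = inverse (eval_fps F x) * eval_fps (fps_deriv F) x"
    using x(2) by (simp add: fps_log_deriv_def eval_fps_mult)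
  then show ?thesis
    using DERIV_chain2[OF DERIV_ln[OF assms(2)] has_field_derivative_eval_fps[OF x(1)]] by simp
qed

section \<open>Reciprocals with nonnegative coefficients\<close>

definition fps_of_real :: "real fps \<Rightarrow> 'a::real_algebra_1 fps" where
  "fps_of_real F = Abs_fps (\<lambda>n. of_real (F $ n))"

lemma fps_of_real_nth [simp]: "fps_of_real F $ n = of_real (F $ n)"
  by (simp add: fps_of_real_def)

lemma fps_of_real_mult: "fps_of_real (F * G) = fps_of_real F * fps_of_real G"
  by (rule fps_ext) (simp add: fps_mult_nth)

lemma fps_of_real_inverse:
  assumes "F $ 0 \<noteq> 0"
  shows "fps_of_real (inverse F) = (inverse (fps_of_real F) :: 'a::real_div_algebra fps)"
proof -
  have "fps_of_real F * fps_of_real (inverse F) = (fps_of_real 1 :: 'a fps)"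
    using assms by (simp add: inverse_mult_eq_1' flip: fps_of_real_mult)
  also have "fps_of_real 1 = 1"
    by (rule fps_ext) simp
  finally show ?thesis by (rule fps_inverse_unique[symmetric])
qed

lemma fps_conv_radius_of_real [simp]: "fps_conv_radius (fps_of_real F) = fps_conv_radius F"
  by (simp add: fps_conv_radius_def conv_radius_def)

lemma norm_eval_fps_of_real_le:
  fixes z :: "'a::{banach, real_normed_div_algebra}"
  assumes nonneg: "fps_nonneg F" and z: "ereal (norm z) < fps_conv_radius F"
  shows "norm (eval_fps (fps_of_real F) z) \<le> eval_fps F (norm z)"
proof -
  have norm_term: "norm (fps_of_real F $ n * z ^ n) = F $ n * norm z ^ n" for n
    using nonneg by (simp add: norm_mult norm_power fps_nonneg_le_nth)
  have "summable (\<lambda>n. norm (fps_of_real F $ n * z ^ n))"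
    using z by (intro norm_summable_fps) simp
  then have "norm (\<Sum>n. fps_of_real F $ n * z ^ n) \<le> (\<Sum>n. norm (fps_of_real F $ n * z ^ n))"
    by (rule summable_norm)
  then show ?thesis
    unfolding norm_term by (simp add: eval_fps_def)
qed

lemma norm_eval_fps_of_real_ge:
  fixes z :: "'a::{banach, real_normed_field}"
  assumes nth_0: "f $ 0 \<noteq> 0" and nonneg: "fps_nonneg (inverse f)"
    and z: "ereal (norm z) < fps_conv_radius f" "ereal (norm z) < fps_conv_radius (inverse f)"
  shows "norm (eval_fps f (norm z)) \<le> norm (eval_fps (fps_of_real f) z)"
proof -
  have inverse_nonneg: "0 \<le> eval_fps (inverse f) (norm z)"
    using norm_eval_fps_of_real_le[OF nonneg z(2)] by (rule order_trans[OF norm_ge_zero])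
  have "eval_fps (fps_of_real f) z * eval_fps (fps_of_real (inverse f)) z = 1"
    unfolding fps_of_real_inverse[OF nth_0]
    using nth_0 z by (intro eval_fps_mult_inverse) (simp_all flip: fps_of_real_inverse)
  then have "1 = norm (eval_fps (fps_of_real f) z) * norm (eval_fps (fps_of_real (inverse f)) z)"
    by (metis norm_mult norm_one)
  also have "\<dots> \<le> norm (eval_fps (fps_of_real f) z) * eval_fps (inverse f) (norm z)"
    using norm_eval_fps_of_real_le[OF nonneg z(2)] by (rule mult_left_mono) simp
  finally have "norm (eval_fps f (norm z))
      \<le> norm (eval_fps (fps_of_real f) z) * eval_fps (inverse f) (norm z)
        * norm (eval_fps f (norm z))"
    by (simp add: mult_le_cancel_right1)
  also have "\<dots> = norm (eval_fps (fps_of_real f) z)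
      * \<bar>eval_fps f (norm z) * eval_fps (inverse f) (norm z)\<bar>"
    using inverse_nonneg by (simp add: abs_mult)
  also have "eval_fps f (norm z) * eval_fps (inverse f) (norm z) = 1"
    using nth_0 z by (intro eval_fps_mult_inverse) simp_all
  finally show ?thesis by simp
qed

lemma fps_conv_radius_inverse_real:
  fixes r :: ereal
  assumes nth_0: "f $ 0 \<noteq> 0"
    and nonzero: "\<And>z :: complex. ereal (norm z) < r \<Longrightarrow> eval_fps (fps_of_real f) z \<noteq> 0"
  shows "min r (fps_conv_radius f) \<le> fps_conv_radius (inverse f)"
proof -
  have "min r (fps_conv_radius (fps_of_real f :: complex fps))
      \<le> fps_conv_radius (inverse (fps_of_real f) :: complex fps)"
    using nonzero by (rule fps_conv_radius_inverse)
  then show ?thesis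
    using nth_0 by (simp flip: fps_of_real_inverse)
qed

lemma eval_fps_zero_of_minimal_norm:
  fixes F :: "'a::{banach, real_normed_field, heine_borel} fps"
  assumes w: "ereal (norm w) < fps_conv_radius F" "eval_fps F w = 0"
  obtains z where "norm z \<le> norm w" "eval_fps F z = 0"
    and "\<And>y. norm y < norm z \<Longrightarrow> eval_fps F y \<noteq> 0"
proof -
  define Z where "Z = {z \<in> cball 0 (norm w). eval_fps F z = 0}"
  have "ereal (norm z) < fps_conv_radius F" if "z \<in> cball 0 (norm w)" for z :: 'a
    using that by (intro le_less_trans[OF _ w(1)]) simp
  then have "continuous_on (cball 0 (norm w)) (eval_fps F)"
    by (auto intro!: continuous_intros)
  then have "closed Z"
    unfolding Z_def by (rule continuous_closed_preimage_constant) simp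
  moreover have "bounded Z"
    by (auto simp: Z_def bounded_iff)
  ultimately have "compact Z"
    by (simp add: compact_eq_bounded_closed)
  moreover have "w \<in> Z"
    using w(2) by (simp add: Z_def)
  ultimately obtain z where z: "z \<in> Z" "\<And>y. y \<in> Z \<Longrightarrow> norm z \<le> norm y"
    using continuous_attains_inf[of Z norm] continuous_on_norm_id by blast
  show ?thesis
  proof
    show "norm z \<le> norm w" "eval_fps F z = 0"
      using z(1) by (simp_all add: Z_def)
    show "eval_fps F y \<noteq> 0" if "norm y < norm z" for y
    proof
      assume "eval_fps F y = 0"
      then have "y \<in> Z"
        using z(1) that by (simp add: Z_def)
      with z(2)[of y] that show False by simp
    qed
  qed
qed

text \<open>The series \<open>1/f\<close> converges for \<open>|w| < |z|\<close>, so \<open>|1/f(w)| \<le> 1/f(|w|)\<close> there. By continuity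
  \<open>|f(|z|)| \<le> |f(z)| = 0\<close>.\<close>

lemma eval_fps_norm_minimal_zero:
  fixes z :: complex
  assumes nth_0: "f $ 0 \<noteq> 0" and nonneg: "fps_nonneg (inverse f)"
    and z: "ereal (norm z) < fps_conv_radius f"
    and zero: "eval_fps (fps_of_real f) z = 0"
    and minimal: "\<And>w :: complex. norm w < norm z \<Longrightarrow> eval_fps (fps_of_real f) w \<noteq> 0"
  shows "eval_fps f (norm z) = 0"
proof -
  let ?defect = "\<lambda>w :: complex. norm (eval_fps f (norm w)) - norm (eval_fps (fps_of_real f) w)"
  have "min (ereal (norm z)) (fps_conv_radius f) \<le> fps_conv_radius (inverse f)"
    using minimal by (intro fps_conv_radius_inverse_real nth_0) simp
  then have inverse_radius: "ereal (norm z) \<le> fps_conv_radius (inverse f)"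
    using z by simp
  have in_ball: "?defect w \<le> 0" if "w \<in> ball 0 (norm z)" for w
  proof -
    have "ereal (norm w) < ereal (norm z)" using that by simp
    then have "norm (eval_fps f (norm w)) \<le> norm (eval_fps (fps_of_real f) w)"
      using z inverse_radius by (intro norm_eval_fps_of_real_ge nth_0 nonneg) order+
    then show ?thesis by simp
  qed
  have "z \<noteq> 0"
    using zero nth_0 by (auto simp: eval_fps_at_0)
  then have closure: "closure (ball (0 :: complex) (norm z)) = cball 0 (norm z)"
    by simp
  have "ereal (norm w) < fps_conv_radius f" if "w \<in> cball 0 (norm z)" for w :: complex
    using that by (intro le_less_trans[OF _ z]) simp
  then have "continuous_on (closure (ball 0 (norm z))) ?defect"
    unfolding closure by (auto intro!: continuous_intros)
  then have "?defect z \<le> 0"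
    by (rule continuous_le_on_closure) (use closure in_ball in auto)
  with zero show ?thesis by simp
qed

lemma fps_conv_radius_inverse_ge_first_pos_zero:
  fixes f :: "real fps" and a :: ereal
  assumes nonneg: "fps_nonneg (inverse f)" and radius: "a \<le> fps_conv_radius f"
    and nonzero: "\<And>x. 0 \<le> x \<Longrightarrow> ereal x < a \<Longrightarrow> eval_fps f x \<noteq> 0"
  shows "a \<le> fps_conv_radius (inverse f)"
proof (rule ccontr)
  assume less: "\<not> a \<le> fps_conv_radius (inverse f)"
  moreover have "0 \<le> fps_conv_radius (inverse f)"
    unfolding fps_conv_radius_def by (rule conv_radius_nonneg)
  ultimately have "0 < a" by order
  then have nth_0: "f $ 0 \<noteq> 0"
    using nonzero[of 0] by (simp add: eval_fps_at_0 zero_ereal_def)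
  obtain w :: complex where w: "ereal (norm w) < a" "eval_fps (fps_of_real f) w = 0"
    using fps_conv_radius_inverse_real[OF nth_0, of a] radius less by (auto simp: min_absorb1)
  have "ereal (norm w) < fps_conv_radius (fps_of_real f :: complex fps)"
    using w(1) radius by simp
  then obtain z :: complex where z: "norm z \<le> norm w" "eval_fps (fps_of_real f) z = 0"
    and minimal: "\<And>y :: complex. norm y < norm z \<Longrightarrow> eval_fps (fps_of_real f) y \<noteq> 0"
    using eval_fps_zero_of_minimal_norm[OF _ w(2)] by metis
  have "ereal (norm z) < a"
    using z(1) w(1) by (intro le_less_trans[OF _ w(1)]) simp
  moreover from this have "eval_fps f (norm z) = 0"
    using radius z(2) minimal by (intro eval_fps_norm_minimal_zero nth_0 nonneg) auto
  ultimately show False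
    using nonzero[of "norm z"] by simp
qed

section \<open>Absolute monotonicity of power series\<close>

lemma absolutely_monotonic_on_cmult:
  assumes "absolutely_monotonic_on I f" "0 \<le> c"
  shows "absolutely_monotonic_on I (\<lambda>x. c * f x)"
proof -
  obtain F where "\<forall>x\<in>I. F 0 x = f x" "\<forall>n. \<forall>x\<in>I. 0 \<le> F n x"
    and "\<forall>n. \<forall>x\<in>I. (F n has_real_derivative F (Suc n) x) (at x within I)"
    using assms(1) unfolding absolutely_monotonic_on_def by blast
  with \<open>0 \<le> c\<close> show ?thesis
    unfolding absolutely_monotonic_on_def
    by (intro exI[of _ "\<lambda>n x. c * F n x"]) (auto intro: DERIV_cmult)
qed

lemma absolutely_monotonic_on_eval_fps:
  assumes nonneg: "fps_nonneg F" and radius: "ereal a \<le> fps_conv_radius F"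
  shows "absolutely_monotonic_on {0..<a} (eval_fps F)"
proof -
  define D where "D n = (fps_deriv ^^ n) F" for n
  have "fps_nonneg (D n)" and D_radius: "ereal a \<le> fps_conv_radius (D n)" for n
  proof (induction n)
    case (Suc n)
    case 1
    show ?case using Suc(1) by (simp add: D_def fps_nonneg_le_deriv)
    case 2
    show ?case using Suc(2) fps_conv_radius_deriv[of "D n"] by (simp add: D_def)
  qed (use nonneg radius in \<open>simp_all add: D_def\<close>)
  show ?thesis
    unfolding absolutely_monotonic_on_def
  proof (intro exI[of _ "\<lambda>n. eval_fps (D n)"] conjI allI ballI)
    fix n x assume x: "x \<in> {0..<a}"
    then have inside: "ereal (norm x) < fps_conv_radius (D n)"
      using D_radius by (rule norm_less_fps_conv_radius)
    then have "(eval_fps (D n) has_real_derivative eval_fps (fps_deriv (D n)) x)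
        (at x within {0..<a})"
      by (rule has_field_derivative_eval_fps)
    then show "(eval_fps (D n) has_real_derivative eval_fps (D (Suc n)) x) (at x within {0..<a})"
      by (simp add: D_def)
    have "0 \<le> D n $ 0"
      using \<open>fps_nonneg (D n)\<close> by (rule fps_nonneg_le_nth)
    also have "\<dots> \<le> eval_fps (D n) x"
      using x inside \<open>fps_nonneg (D n)\<close> by (intro eval_fps_ge_nth_0) simp_all
    finally show "0 \<le> eval_fps (D n) x" .
  qed (simp add: D_def)
qed

lemma absolutely_monotonic_on_ext0:
  assumes f: "absolutely_monotonic_on {0..<a} f" and h: "\<And>x. 0 < x \<Longrightarrow> x < a \<Longrightarrow> h x = f x"
  shows "absolutely_monotonic_on {0..<a} (ext0 h)"
proof -
  obtain F where F_0_eq: "\<forall>x\<in>{0..<a}. F 0 x = f x" and nonneg: "\<forall>n. \<forall>x\<in>{0..<a}. 0 \<le> F n x"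
    and deriv: "\<forall>n. \<forall>x\<in>{0..<a}. (F n has_real_derivative F (Suc n) x) (at x within {0..<a})"
    using f unfolding absolutely_monotonic_on_def by blast
  have ext0_0: "ext0 h 0 = F 0 0" if "0 < a"
  proof -
    have "(F 0 has_real_derivative F (Suc 0) 0) (at 0 within {0..<a})"
      using deriv that by simp
    moreover have "at 0 within {0..<a} = at_right 0"
      using that by (intro at_within_nhd[of _ "{..<a}"]) auto
    ultimately have "(F 0 \<longlongrightarrow> F 0 0) (at_right 0)"
      using DERIV_continuous by (fastforce simp: continuous_within)
    moreover have "\<forall>\<^sub>F x in at_right 0. F 0 x = h x"
      using eventually_at_right_real[OF that] by eventually_elim (use F_0_eq h in simp)
    ultimately have "(h \<longlongrightarrow> F 0 0) (at_right 0)"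
      by (rule Lim_transform_eventually)
    then show ?thesis
      by (simp add: ext0_def tendsto_Lim)
  qed
  have "F 0 x = ext0 h x" if "x \<in> {0..<a}" for x
    using that F_0_eq h[of x] ext0_0 by (cases "x = 0") (simp_all add: ext0_def)
  with nonneg deriv show ?thesis
    unfolding absolutely_monotonic_on_def by blast
qed

section \<open>The normalised Bessel and Dini series\<close>

text \<open>\<open>2\<^sup>\<nu> \<Gamma>(\<nu> + 1) x\<^bsup>-\<nu>/2\<^esup> J\<^sub>\<nu>(\<surd>x)\<close> as a power series in \<open>x\<close>.\<close>

definition bessel_fps :: "real \<Rightarrow> real fps" where
  "bessel_fps \<nu> = Abs_fps (\<lambda>k. (-1) ^ k / (4 ^ k * fact k * pochhammer (\<nu> + 1) k))"

definition dini_fps :: "real \<Rightarrow> real fps" where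
  "dini_fps \<nu> = bessel_fps \<nu> + 2 * fps_X * fps_deriv (bessel_fps \<nu>)"

lemma bessel_fps_nth_0 [simp]: "bessel_fps \<nu> $ 0 = 1"
  by (simp add: bessel_fps_def)

lemma dini_fps_nth_0 [simp]: "dini_fps \<nu> $ 0 = 1"
  by (simp add: dini_fps_def)

lemma bessel_fps_nth_Suc:
  assumes "\<nu> > -1"
  shows "(real n + 1) * (real n + \<nu> + 1) * bessel_fps \<nu> $ Suc n = - bessel_fps \<nu> $ n / 4"
proof -
  have "\<nu> + 1 + real n \<noteq> 0" "pochhammer (\<nu> + 1) n \<noteq> 0"
    using assms pochhammer_pos[of "\<nu> + 1" n] by auto
  then show ?thesis
    by (simp add: bessel_fps_def pochhammer_Suc divide_simps) (simp add: algebra_simps)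
qed

lemma fps_conv_radius_bessel_fps [simp]:
  assumes "\<nu> > -1"
  shows "fps_conv_radius (bessel_fps \<nu>) = \<infinity>"
  unfolding fps_conv_radius_def
proof (rule conv_radius_ratio_limit_ereal_nonzero)
  let ?u = "fps_nth (bessel_fps \<nu>)"
  have "norm (?u n) / norm (?u (Suc n)) = 4 * (real n + 1) * (real n + \<nu> + 1)" for n
  proof -
    have "?u (Suc n) \<noteq> 0"
      using assms pochhammer_pos[of "\<nu> + 1" "Suc n"] by (simp add: bessel_fps_def)
    moreover have "?u n = - (4 * (real n + 1) * (real n + \<nu> + 1)) * ?u (Suc n)"
      using bessel_fps_nth_Suc[OF assms, of n] by (simp add: algebra_simps)
    ultimately show ?thesis using assms by (simp add: abs_mult)
  qed
  moreover have "filterlim (\<lambda>n. 4 * (real n + 1) * (real n + \<nu> + 1)) at_top sequentially"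
    by real_asymp
  ultimately show "(\<lambda>n. ereal (norm (?u n) / norm (?u (Suc n)))) \<longlonglongrightarrow> \<infinity>"
    by (simp add: tendsto_PInfty_eq_at_top)
qed simp

lemma fps_conv_radius_deriv_bessel_fps [simp]:
  "\<nu> > -1 \<Longrightarrow> fps_conv_radius (fps_deriv (bessel_fps \<nu>)) = \<infinity>"
  using fps_conv_radius_deriv[of "bessel_fps \<nu>"] by simp

lemma fps_conv_radius_dini_fps [simp]:
  assumes "\<nu> > -1"
  shows "fps_conv_radius (dini_fps \<nu>) = \<infinity>"
proof -
  have "\<infinity> \<le> fps_conv_radius (dini_fps \<nu>)"
    unfolding dini_fps_def
    by (intro fps_conv_radius_add_ge fps_conv_radius_mult_ge) (use assms in simp_all)
  then show ?thesis by simp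
qed

lemma eval_fps_dini_fps:
  assumes "\<nu> > -1"
  shows "eval_fps (dini_fps \<nu>) x
    = eval_fps (bessel_fps \<nu>) x + 2 * x * eval_fps (fps_deriv (bessel_fps \<nu>)) x"
proof -
  have "\<infinity> \<le> fps_conv_radius (2 * fps_X * fps_deriv (bessel_fps \<nu>))"
    "\<infinity> \<le> fps_conv_radius (2 * fps_X :: real fps)"
    by (intro fps_conv_radius_mult_ge; use assms in simp)+
  then show ?thesis
    using assms by (simp add: dini_fps_def eval_fps_add eval_fps_mult)
qed

lemma besselJ_summand_eq:
  assumes "\<nu> > -1" "x > 0"
  shows "(-1) ^ k / (fact k * Gamma (real k + \<nu> + 1)) * (x / 2) powr (2 * real k + \<nu>)
    = (x / 2) powr \<nu> / Gamma (\<nu> + 1) * (bessel_fps \<nu> $ k * (x\<^sup>2) ^ k)"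
proof -
  have "\<nu> + 1 \<notin> \<int>\<^sub>\<le>\<^sub>0"
    using assms by (auto elim!: nonpos_Ints_cases)
  then have Gamma: "Gamma (real k + \<nu> + 1) = Gamma (\<nu> + 1) * pochhammer (\<nu> + 1) k"
    by (simp add: pochhammer_Gamma Gamma_eq_zero_iff add_ac)
  have "(x / 2) powr (2 * real k) = (x / 2) ^ (2 * k)"
    using assms powr_realpow[of "x / 2" "2 * k"] by simp
  then have "(x / 2) powr (2 * real k + \<nu>) = (x\<^sup>2) ^ k / 4 ^ k * (x / 2) powr \<nu>"
    by (simp add: powr_add power_mult power_divide)
  with Gamma show ?thesis
    by (simp add: bessel_fps_def mult_ac)
qed

lemma besselJ_eq_eval_fps:
  assumes "\<nu> > -1" "x > 0"
  shows "besselJ \<nu> x = (x / 2) powr \<nu> / Gamma (\<nu> + 1) * eval_fps (bessel_fps \<nu>) (x\<^sup>2)"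
  unfolding besselJ_def besselJ_summand_eq[OF assms] eval_fps_def
  using assms by (intro suminf_mult summable_fps) simp

lemma has_real_derivative_besselJ:
  assumes "\<nu> > -1" "x > 0"
  shows "(besselJ \<nu> has_real_derivative (x / 2) powr \<nu> / Gamma (\<nu> + 1)
    * (\<nu> / x * eval_fps (bessel_fps \<nu>) (x\<^sup>2)
      + 2 * x * eval_fps (fps_deriv (bessel_fps \<nu>)) (x\<^sup>2))) (at x)"
proof -
  let ?u = "eval_fps (bessel_fps \<nu>)" and ?u' = "eval_fps (fps_deriv (bessel_fps \<nu>))"
  have "(?u has_real_derivative ?u' (x\<^sup>2)) (at (x\<^sup>2))"
    using assms by (intro has_field_derivative_eval_fps) simp
  then have "((\<lambda>t. ?u (t\<^sup>2)) has_real_derivative ?u' (x\<^sup>2) * (2 * x)) (at x)"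
    by (rule DERIV_chain2) (auto intro!: derivative_eq_intros)
  moreover have "((\<lambda>t. (t / 2) powr \<nu>) has_real_derivative (x / 2) powr \<nu> * \<nu> / x) (at x)"
    using assms by (auto intro!: derivative_eq_intros simp: powr_diff)
  ultimately have "((\<lambda>t. (t / 2) powr \<nu> * ?u (t\<^sup>2) / Gamma (\<nu> + 1)) has_real_derivative
      ((x / 2) powr \<nu> * \<nu> / x * ?u (x\<^sup>2) + ?u' (x\<^sup>2) * (2 * x) * (x / 2) powr \<nu>)
        / Gamma (\<nu> + 1)) (at x)"
    by (intro DERIV_cdivide DERIV_mult)
  then have "((\<lambda>t. (t / 2) powr \<nu> * ?u (t\<^sup>2) / Gamma (\<nu> + 1)) has_real_derivative
      (x / 2) powr \<nu> / Gamma (\<nu> + 1) * (\<nu> / x * ?u (x\<^sup>2) + 2 * x * ?u' (x\<^sup>2))) (at x)"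
    by (rule DERIV_cong) (simp add: add_divide_distrib distrib_left mult_ac)
  then show ?thesis
    by (rule has_field_derivative_transform_within_open[where S = "{0<..}"])
       (use assms in \<open>auto simp: besselJ_eq_eval_fps\<close>)
qed

lemma dini_eq_eval_fps:
  assumes "\<nu> > -1" "x > 0"
  shows "dini \<nu> x = (x / 2) powr \<nu> / Gamma (\<nu> + 1) * eval_fps (dini_fps \<nu>) (x\<^sup>2)"
proof -
  define C where "C = (x / 2) powr \<nu> / Gamma (\<nu> + 1)"
  show ?thesis
    using assms DERIV_imp_deriv[OF has_real_derivative_besselJ[OF assms]]
    by (simp add: dini_def besselJ_eq_eval_fps eval_fps_dini_fps flip: C_def)
       (simp add: field_simps power2_eq_square)
qed

section \<open>Monotonicity in the order\<close>

lemma bessel_fps_ode: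
  assumes "\<nu> > -1"
  shows "fps_X * fps_deriv (fps_deriv (bessel_fps \<nu>))
    + fps_const (\<nu> + 1) * fps_deriv (bessel_fps \<nu>)
    + fps_const (1 / 4) * bessel_fps \<nu> = 0" (is "?lhs = 0")
proof (rule fps_ext)
  fix n
  show "?lhs $ n = 0 $ n"
    using bessel_fps_nth_Suc[OF assms, of n] by (cases n) (simp_all add: algebra_simps)
qed

lemma log_deriv_inverse_bessel_fps_riccati:
  fixes \<nu> :: real
  defines "H \<equiv> fps_log_deriv (inverse (bessel_fps \<nu>))"
  assumes "\<nu> > -1"
  shows "fps_X * fps_deriv H + fps_const (\<nu> + 1) * H = fps_X * (H * H) + fps_const (1 / 4)"
proof -
  let ?U = "bessel_fps \<nu>"
  have H_eq: "H = - (fps_deriv ?U * inverse ?U)"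
    unfolding H_def fps_log_deriv_def[of ?U, symmetric] by (simp add: fps_log_deriv_inverse)
  have deriv_H: "fps_deriv H = - (fps_deriv (fps_deriv ?U) * inverse ?U) + H * H"
    by (simp add: H_def fps_log_deriv_inverse fps_deriv_log_deriv power2_eq_square)
  have "(fps_X * fps_deriv (fps_deriv ?U) + fps_const (\<nu> + 1) * fps_deriv ?U
      + fps_const (1 / 4) * ?U) * inverse ?U = 0"
    using bessel_fps_ode[OF \<open>\<nu> > -1\<close>] by simp
  then have "fps_X * (H * H - fps_deriv H) - fps_const (\<nu> + 1) * H + fps_const (1 / 4) = 0"
    unfolding deriv_H by (simp add: H_eq distrib_right mult.assoc inverse_mult_eq_1')
  then show ?thesis
    by (simp add: algebra_simps)
qed

lemma log_deriv_inverse_bessel_fps_nth_0: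
  assumes "\<nu> > -1"
  shows "fps_log_deriv (inverse (bessel_fps \<nu>)) $ 0 = 1 / (4 * (\<nu> + 1))"
  using assms arg_cong[OF log_deriv_inverse_bessel_fps_riccati[OF assms], of "\<lambda>F. F $ 0"]
  by (simp add: field_simps)

lemma log_deriv_inverse_bessel_fps_nth_Suc:
  fixes \<nu> :: real
  defines "H \<equiv> fps_log_deriv (inverse (bessel_fps \<nu>))"
  assumes "\<nu> > -1"
  shows "H $ Suc n = (H * H) $ n / (real (Suc n) + \<nu> + 1)"
proof -
  have "(real (Suc n) + \<nu> + 1) * H $ Suc n
      = (fps_X * fps_deriv H + fps_const (\<nu> + 1) * H) $ Suc n"
    by (simp add: algebra_simps)
  also have "\<dots> = (H * H) $ n"
    unfolding H_def log_deriv_inverse_bessel_fps_riccati[OF \<open>\<nu> > -1\<close>] by simp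
  finally show ?thesis
    using \<open>\<nu> > -1\<close> by (simp add: eq_divide_eq mult.commute)
qed

lemma log_deriv_inverse_bessel_fps_antimono:
  assumes "\<nu> > -1" "\<mu> \<ge> \<nu>"
  shows "fps_nonneg_le (fps_log_deriv (inverse (bessel_fps \<mu>)))
    (fps_log_deriv (inverse (bessel_fps \<nu>)))"
    (is "fps_nonneg_le ?H ?K")
proof (induction rule: fps_nonneg_le_induct)
  case 0
  show ?case
    using assms by (simp add: log_deriv_inverse_bessel_fps_nth_0 frac_le)
next
  case (Suc n)
  then have "fps_nonneg_le_upto n (?H * ?H) (?K * ?K)"
    by (intro fps_nonneg_le_upto_mult)
  then have "0 \<le> (?H * ?H) $ n" "(?H * ?H) $ n \<le> (?K * ?K) $ n"
    by (simp_all add: fps_nonneg_le_upto_def)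
  then show ?case
    using assms by (simp add: log_deriv_inverse_bessel_fps_nth_Suc frac_le)
qed

lemma log_deriv_inverse_dini_fps:
  fixes \<nu> :: real
  defines "H \<equiv> fps_log_deriv (inverse (bessel_fps \<nu>))"
  shows "fps_log_deriv (inverse (dini_fps \<nu>))
    = H + fps_deriv (2 * fps_X * H) * inverse (1 - 2 * fps_X * H)"
proof -
  let ?U = "bessel_fps \<nu>"
  have "fps_deriv ?U = - H * ?U"
    by (simp add: H_def fps_log_deriv_inverse fps_log_deriv_times_self)
  then have "dini_fps \<nu> = ?U * (1 - 2 * fps_X * H)"
    by (simp add: dini_fps_def algebra_simps)
  then have "fps_log_deriv (inverse (dini_fps \<nu>)) = H - fps_log_deriv (1 - 2 * fps_X * H)"
    by (simp add: H_def fps_log_deriv_inverse fps_log_deriv_mult)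
  also have "fps_log_deriv (1 - 2 * fps_X * H)
      = - (fps_deriv (2 * fps_X * H) * inverse (1 - 2 * fps_X * H))"
    by (simp add: fps_log_deriv_def algebra_simps)
  finally show ?thesis by simp
qed

lemma log_deriv_inverse_dini_fps_antimono:
  assumes "\<nu> > -1" "\<mu> \<ge> \<nu>"
  shows "fps_nonneg_le (fps_log_deriv (inverse (dini_fps \<mu>)))
    (fps_log_deriv (inverse (dini_fps \<nu>)))"
proof -
  note bessel = log_deriv_inverse_bessel_fps_antimono[OF assms]
  have "fps_nonneg (2 :: real fps)" "fps_nonneg (fps_X :: real fps)"
    by (simp_all add: fps_nonneg_le_def fps_numeral_nth)
  then show ?thesis
    unfolding log_deriv_inverse_dini_fps
    by (intro fps_nonneg_le_add fps_nonneg_le_mult fps_nonneg_le_deriv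
        fps_nonneg_le_inverse_one_minus bessel) simp_all
qed

lemma log_deriv_inverse_dini_fps_nth_0:
  "fps_log_deriv (inverse (dini_fps \<nu>)) $ 0 = 3 / (4 * (\<nu> + 1))"
proof -
  have "fps_log_deriv (inverse (dini_fps \<nu>)) $ 0 = - dini_fps \<nu> $ 1"
    by (simp add: fps_log_deriv_inverse) (simp add: fps_log_deriv_def)
  then show ?thesis
    by (simp add: dini_fps_def bessel_fps_def mult.assoc)
qed

section \<open>Canonical Dini products\<close>

text \<open>In terms of the positive zeros \<open>\<alpha>\<^sub>k\<close> of the Dini function, this is the Weierstrass product
  \<open>\<Prod>\<^sub>k (1 - x/\<alpha>\<^sub>k\<^sup>2) exp (x/\<alpha>\<^sub>k\<^sup>2)\<close>, which has no linear term.\<close>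

definition dini_canonical_fps :: "real \<Rightarrow> real fps" where
  "dini_canonical_fps \<nu> = dini_fps \<nu> * fps_exp (3 / (4 * (\<nu> + 1)))"

lemma dini_canonical_fps_nth_0 [simp]: "dini_canonical_fps \<nu> $ 0 = 1"
  by (simp add: dini_canonical_fps_def)

lemma fps_conv_radius_dini_canonical_fps [simp]:
  assumes "\<nu> > -1"
  shows "fps_conv_radius (dini_canonical_fps \<nu>) = \<infinity>"
proof -
  have "\<infinity> \<le> fps_conv_radius (dini_canonical_fps \<nu>)"
    unfolding dini_canonical_fps_def
    by (intro fps_conv_radius_mult_ge) (use assms in simp_all)
  then show ?thesis by simp
qed

lemma eval_fps_dini_canonical_fps:
  assumes "\<nu> > -1"
  shows "eval_fps (dini_canonical_fps \<nu>) x = eval_fps (dini_fps \<nu>) x * exp (3 * x / (4 * (\<nu> + 1)))"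
  using assms by (simp add: dini_canonical_fps_def eval_fps_mult)

lemma log_deriv_inverse_dini_canonical_fps:
  "fps_log_deriv (inverse (dini_canonical_fps \<nu>))
    = fps_log_deriv (inverse (dini_fps \<nu>)) - fps_const (3 / (4 * (\<nu> + 1)))"
  by (simp add: dini_canonical_fps_def fps_log_deriv_inverse fps_log_deriv_mult fps_log_deriv_exp
      del: fps_const_sub)

lemma log_deriv_inverse_dini_canonical_fps_antimono:
  assumes "\<nu> > -1" "\<mu> \<ge> \<nu>"
  shows "fps_nonneg_le (fps_log_deriv (inverse (dini_canonical_fps \<mu>)))
    (fps_log_deriv (inverse (dini_canonical_fps \<nu>)))"
  using log_deriv_inverse_dini_fps_antimono[OF assms]
  by (simp add: fps_nonneg_le_def log_deriv_inverse_dini_canonical_fps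
      log_deriv_inverse_dini_fps_nth_0)

lemma inverse_dini_canonical_fps_antimono:
  assumes "\<nu> > -1" "\<mu> \<ge> \<nu>"
  shows "fps_nonneg_le (inverse (dini_canonical_fps \<mu>)) (inverse (dini_canonical_fps \<nu>))"
  using log_deriv_inverse_dini_canonical_fps_antimono[OF assms]
  by (rule fps_nonneg_le_if_log_deriv) simp_all

lemma eval_fps_dini_fps_nonzero:
  assumes "\<nu> > -1" "0 \<le> x" "x < (dini_zero1 \<nu>)\<^sup>2"
  shows "eval_fps (dini_fps \<nu>) x \<noteq> 0"
proof (cases "x = 0")
  case False
  show ?thesis
  proof
    assume "eval_fps (dini_fps \<nu>) x = 0"
    with False assms have "sqrt x \<in> {x. 0 < x \<and> dini \<nu> x = 0}"
      by (simp add: dini_eq_eval_fps)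
    then have "dini_zero1 \<nu> \<le> sqrt x" "0 \<le> dini_zero1 \<nu>"
      unfolding dini_zero1_def
      by (auto intro!: cInf_lower cInf_greatest bdd_belowI[of _ 0] simp del: real_sqrt_gt_0_iff)
    then have "(dini_zero1 \<nu>)\<^sup>2 \<le> (sqrt x)\<^sup>2" by (rule power_mono)
    with assms show False by simp
  qed
qed (simp add: eval_fps_at_0)

lemma fps_conv_radius_inverse_dini_canonical_fps_ge:
  assumes "\<nu> > -1" "\<mu> \<ge> \<nu>"
  shows "ereal ((dini_zero1 \<nu>)\<^sup>2) \<le> fps_conv_radius (inverse (dini_canonical_fps \<mu>))"
proof -
  have "ereal ((dini_zero1 \<nu>)\<^sup>2) \<le> fps_conv_radius (inverse (dini_canonical_fps \<nu>))"
    using assms inverse_dini_canonical_fps_antimono[of \<nu> \<nu>]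
    by (intro fps_conv_radius_inverse_ge_first_pos_zero)
       (simp_all add: eval_fps_dini_canonical_fps eval_fps_dini_fps_nonzero)
  also have "\<dots> \<le> fps_conv_radius (inverse (dini_canonical_fps \<mu>))"
    using fps_nonneg_le_nth[OF inverse_dini_canonical_fps_antimono[OF assms]]
    by (intro fps_conv_radius_antimono) (auto intro: order_trans[OF _ abs_ge_self])
  finally show ?thesis .
qed

lemma eval_fps_inverse_dini_canonical_fps:
  assumes "\<nu> > -1" "x \<in> {0..<(dini_zero1 \<nu>)\<^sup>2}"
  shows "eval_fps (inverse (dini_canonical_fps \<nu>)) x = inverse (eval_fps (dini_canonical_fps \<nu>) x)"
proof -
  have "ereal (norm x) < fps_conv_radius (inverse (dini_canonical_fps \<nu>))"
    by (rule norm_less_fps_conv_radius[OF assms(2) fps_conv_radius_inverse_dini_canonical_fps_ge])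
       (use assms in simp_all)
  then have "eval_fps (dini_canonical_fps \<nu>) x * eval_fps (inverse (dini_canonical_fps \<nu>)) x = 1"
    using assms by (intro eval_fps_mult_inverse) simp_all
  then show ?thesis by (simp add: inverse_unique)
qed

section \<open>Absolute monotonicity of \<open>q\<close>, \<open>g\<close> and \<open>f\<close>\<close>

definition dini_const :: "real \<Rightarrow> real" where
  "dini_const \<nu> = 2 powr \<nu> * Gamma (\<nu> + 1)"

lemma dini_const_pos: "\<nu> > -1 \<Longrightarrow> dini_const \<nu> > 0"
  by (simp add: dini_const_def Gamma_real_pos)

lemma q_raw_eq_eval_fps:
  assumes "\<nu> > -1" "x > 0"
  shows "q_raw \<nu> x = dini_const \<nu> / eval_fps (dini_canonical_fps \<nu>) x"
proof -
  have "(sqrt x / 2) powr \<nu> = x powr (\<nu> / 2) / 2 powr \<nu>"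
    using assms by (simp add: powr_divide powr_powr flip: powr_half_sqrt)
  then have dini: "dini \<nu> (sqrt x)
      = x powr (\<nu> / 2) / dini_const \<nu> * eval_fps (dini_fps \<nu>) x"
    using assms by (simp add: dini_eq_eval_fps dini_const_def)
  have "exp (- (3 * x) / (4 * (\<nu> + 1))) = 1 / exp (3 * x / (4 * (\<nu> + 1)))"
    by (simp add: exp_minus inverse_eq_divide)
  then show ?thesis
    using assms by (simp add: q_raw_def dini eval_fps_dini_canonical_fps mult_ac)
qed

lemma g_raw_eq_q_raw_divide: "g_raw \<mu> \<nu> x = q_raw \<nu> x / q_raw \<mu> x"
proof -
  have "3 * x / 4 * (1 / (\<mu> + 1) - 1 / (\<nu> + 1))
      = - (3 * x) / (4 * (\<nu> + 1)) - - (3 * x) / (4 * (\<mu> + 1))"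
    by (simp add: right_diff_distrib)
  then have "exp (3 * x / 4 * (1 / (\<mu> + 1) - 1 / (\<nu> + 1)))
      = exp (- (3 * x) / (4 * (\<nu> + 1))) / exp (- (3 * x) / (4 * (\<mu> + 1)))"
    by (simp only: exp_diff)
  then show ?thesis
    by (simp add: g_raw_def q_raw_def powr_diff diff_divide_distrib)
qed

lemma absolutely_monotonic_on_q_fun:
  assumes "\<nu> > -1"
  shows "absolutely_monotonic_on {0..<(dini_zero1 \<nu>)\<^sup>2} (q_fun \<nu>)"
  unfolding q_fun_def
proof (rule absolutely_monotonic_on_ext0)
  have "absolutely_monotonic_on {0..<(dini_zero1 \<nu>)\<^sup>2} (eval_fps (inverse (dini_canonical_fps \<nu>)))"
    using assms inverse_dini_canonical_fps_antimono[of \<nu> \<nu>]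
      fps_conv_radius_inverse_dini_canonical_fps_ge[of \<nu> \<nu>]
    by (intro absolutely_monotonic_on_eval_fps) simp_all
  then show "absolutely_monotonic_on {0..<(dini_zero1 \<nu>)\<^sup>2}
      (\<lambda>x. dini_const \<nu> * eval_fps (inverse (dini_canonical_fps \<nu>)) x)"
    using dini_const_pos[OF assms] by (intro absolutely_monotonic_on_cmult) simp_all
  fix x assume "0 < x" "x < (dini_zero1 \<nu>)\<^sup>2"
  then show "q_raw \<nu> x = dini_const \<nu> * eval_fps (inverse (dini_canonical_fps \<nu>)) x"
    using assms by (simp add: q_raw_eq_eval_fps eval_fps_inverse_dini_canonical_fps divide_inverse)
qed

definition dini_ratio_fps :: "real \<Rightarrow> real \<Rightarrow> real fps" where
  "dini_ratio_fps \<mu> \<nu> = dini_canonical_fps \<mu> * inverse (dini_canonical_fps \<nu>)"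

lemma dini_ratio_fps_nth_0 [simp]: "dini_ratio_fps \<mu> \<nu> $ 0 = 1"
  by (simp add: dini_ratio_fps_def)

lemma inverse_dini_ratio_fps: "inverse (dini_ratio_fps \<mu> \<nu>) = dini_ratio_fps \<nu> \<mu>"
  by (simp add: dini_ratio_fps_def fps_inverse_mult mult.commute)

lemma fps_conv_radius_dini_ratio_fps_ge:
  assumes "\<nu> > -1" "\<kappa> \<ge> \<nu>" "\<mu> \<ge> \<nu>"
  shows "ereal ((dini_zero1 \<nu>)\<^sup>2) \<le> fps_conv_radius (dini_ratio_fps \<kappa> \<mu>)"
  unfolding dini_ratio_fps_def
  using assms
  by (intro fps_conv_radius_mult_ge fps_conv_radius_inverse_dini_canonical_fps_ge) simp_all

lemma fps_nonneg_log_deriv_dini_ratio_fps: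
  assumes "\<nu> > -1" "\<mu> \<ge> \<nu>"
  shows "fps_nonneg (fps_log_deriv (dini_ratio_fps \<mu> \<nu>))"
proof -
  have "fps_log_deriv (dini_ratio_fps \<mu> \<nu>) = fps_log_deriv (inverse (dini_canonical_fps \<nu>))
      - fps_log_deriv (inverse (dini_canonical_fps \<mu>))"
    by (simp add: dini_ratio_fps_def fps_log_deriv_mult fps_log_deriv_inverse)
  then show ?thesis
    using fps_nonneg_le_nth(2)[OF log_deriv_inverse_dini_canonical_fps_antimono[OF assms]]
    by (simp add: fps_nonneg_le_def)
qed

lemma fps_nonneg_dini_ratio_fps:
  assumes "\<nu> > -1" "\<mu> \<ge> \<nu>"
  shows "fps_nonneg (dini_ratio_fps \<mu> \<nu>)"
  using fps_nonneg_log_deriv_dini_ratio_fps[OF assms] by (rule fps_nonneg_le_if_log_deriv) simp_all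

lemma g_raw_eq_eval_fps:
  assumes "\<nu> > -1" "\<mu> \<ge> \<nu>" "0 < x" "x < (dini_zero1 \<nu>)\<^sup>2"
  shows "g_raw \<mu> \<nu> x = dini_const \<nu> / dini_const \<mu> * eval_fps (dini_ratio_fps \<mu> \<nu>) x"
proof -
  have "ereal (norm x) < fps_conv_radius (inverse (dini_canonical_fps \<nu>))"
    by (rule norm_less_fps_conv_radius[OF _ fps_conv_radius_inverse_dini_canonical_fps_ge])
       (use assms in auto)
  then have "eval_fps (dini_ratio_fps \<mu> \<nu>) x
      = eval_fps (dini_canonical_fps \<mu>) x / eval_fps (dini_canonical_fps \<nu>) x"
    using assms
    by (simp add: dini_ratio_fps_def eval_fps_mult eval_fps_inverse_dini_canonical_fps
        divide_inverse)
  then show ?thesis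
    using assms by (simp add: g_raw_eq_q_raw_divide q_raw_eq_eval_fps)
qed

lemma absolutely_monotonic_on_g_fun:
  assumes "\<nu> > -1" "\<mu> \<ge> \<nu>"
  shows "absolutely_monotonic_on {0..<(dini_zero1 \<nu>)\<^sup>2} (g_fun \<mu> \<nu>)"
  unfolding g_fun_def
proof (rule absolutely_monotonic_on_ext0)
  show "absolutely_monotonic_on {0..<(dini_zero1 \<nu>)\<^sup>2}
      (\<lambda>x. dini_const \<nu> / dini_const \<mu> * eval_fps (dini_ratio_fps \<mu> \<nu>) x)"
    using assms dini_const_pos[of \<nu>] dini_const_pos[of \<mu>]
    by (intro absolutely_monotonic_on_cmult absolutely_monotonic_on_eval_fps
        fps_nonneg_dini_ratio_fps fps_conv_radius_dini_ratio_fps_ge) simp_all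
qed (use assms g_raw_eq_eval_fps in simp)

lemma f_raw_eq_eval_fps:
  assumes order: "\<nu> > -1" "\<mu> \<ge> \<nu>" and x: "0 < x" "x < (dini_zero1 \<nu>)\<^sup>2"
  shows "f_raw \<mu> \<nu> x = eval_fps (fps_log_deriv (dini_ratio_fps \<mu> \<nu>)) x"
proof -
  let ?G = "dini_ratio_fps \<mu> \<nu>"
  have inside: "ereal (norm t) < fps_conv_radius ?G" "ereal (norm t) < fps_conv_radius (inverse ?G)"
    if "t \<in> {0..<(dini_zero1 \<nu>)\<^sup>2}" for t
    using order norm_less_fps_conv_radius[OF that fps_conv_radius_dini_ratio_fps_ge[OF order(1)]]
    by (simp_all add: inverse_dini_ratio_fps)
  have eval_pos: "0 < eval_fps ?G t" if "t \<in> {0..<(dini_zero1 \<nu>)\<^sup>2}" for t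
    using eval_fps_ge_nth_0[OF fps_nonneg_dini_ratio_fps[OF order], of t] inside(1)[OF that] that
    by simp
  have ln_g_raw: "ln (g_raw \<mu> \<nu> t) = ln (dini_const \<nu> / dini_const \<mu>) + ln (eval_fps ?G t)"
    if "t \<in> {0<..<(dini_zero1 \<nu>)\<^sup>2}" for t
    using that order dini_const_pos[of \<nu>] dini_const_pos[of \<mu>] eval_pos[of t]
    by (simp add: g_raw_eq_eval_fps flip: ln_mult_pos)
  have "((\<lambda>t. ln (eval_fps ?G t)) has_real_derivative eval_fps (fps_log_deriv ?G) x) (at x)"
    using x inside eval_pos by (intro has_real_derivative_ln_eval_fps) simp_all
  then have "((\<lambda>t. ln (dini_const \<nu> / dini_const \<mu>) + ln (eval_fps ?G t)) has_real_derivative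
      eval_fps (fps_log_deriv ?G) x) (at x)"
    by (auto intro: derivative_eq_intros)
  then have "((\<lambda>t. ln (g_raw \<mu> \<nu> t)) has_real_derivative eval_fps (fps_log_deriv ?G) x) (at x)"
    by (rule has_field_derivative_transform_within_open[where S = "{0<..<(dini_zero1 \<nu>)\<^sup>2}"])
       (use x in \<open>simp_all add: ln_g_raw\<close>)
  then show ?thesis
    unfolding f_raw_def by (rule DERIV_imp_deriv)
qed

lemma absolutely_monotonic_on_f_fun:
  assumes "\<nu> > -1" "\<mu> \<ge> \<nu>"
  shows "absolutely_monotonic_on {0..<(dini_zero1 \<nu>)\<^sup>2} (f_fun \<mu> \<nu>)"
  unfolding f_fun_def
proof (rule absolutely_monotonic_on_ext0)
  show "absolutely_monotonic_on {0..<(dini_zero1 \<nu>)\<^sup>2}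
      (eval_fps (fps_log_deriv (dini_ratio_fps \<mu> \<nu>)))"
    using assms
    by (intro absolutely_monotonic_on_eval_fps fps_nonneg_log_deriv_dini_ratio_fps
        fps_conv_radius_log_deriv_ge)
       (simp_all add: inverse_dini_ratio_fps fps_conv_radius_dini_ratio_fps_ge)
qed (use assms f_raw_eq_eval_fps in simp)

theorem theorem2:
  fixes \<mu> \<nu> :: real
  assumes "\<nu> > -1" and "\<mu> \<ge> \<nu>"
  shows "absolutely_monotonic_on {0..<(dini_zero1 \<nu>)\<^sup>2} (f_fun \<mu> \<nu>)
       \<and> absolutely_monotonic_on {0..<(dini_zero1 \<nu>)\<^sup>2} (g_fun \<mu> \<nu>)
       \<and> absolutely_monotonic_on {0..<(dini_zero1 \<nu>)\<^sup>2} (q_fun \<nu>)"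
  using assms
  by (intro conjI absolutely_monotonic_on_f_fun absolutely_monotonic_on_g_fun
      absolutely_monotonic_on_q_fun)

end
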